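(* Let $\{\Pi_j\}$ be a minimal informationally complete (IC) measurement on a $d$-dimensional quantum system, i.e. an IC measurement with exactly $d^2$ outcomes. Then $\{\Pi_j\}$ is balanced if and only if it is a generalized SIC measurement.
   Context: A state $\rho$ is a positive semidefinite operator of trace $1$ on $\mathbb{C}^d$. A measurement is a finite set of positive semidefinite operators $\Pi_j$ on $\mathbb{C}^d$ with $\sum_j\Pi_j=1$ (the identity operator). The operator space is equipped with the Hilbert-Schmidt inner product $\langle\!\langle A|B\rangle\!\rangle=\tr(A^\dagger B)$, and $|A\rangle\!\rangle\langle\!\langle B|$ denotes the superoperator $X\mapsto \tr(B^\dagger X)A$. The trace of superoperators is written $\mathrm{Tr}$. The measurement is informationally complete (IC) if the $\Pi_j$ span the whole operator space; it is minimal IC if in addition it has exactly $d^2$ outcomes. For a positive definite state $\rho$, with $p_j=\tr(\Pi_j\rho)>0$, let $\mathcal{F}(\rho)=\sum_j|\Pi_j\rangle\!\rangle\frac1{p_j}\langle\!\langle\Pi_j|$. The scaled mean square error of the optimal reconstruction (which equals the Cramér-Rao bound) is $\mathcal{E}(\rho)=\mathrm{Tr}\{\mathcal{F}(\rho)^{-1}\}-\tr(\rho^2)$. At the completely mixed state $\rho=1/d$ the scaled mean square error matrix is $\mathcal{C}=\mathcal{F}^{-1}-\frac1{d^2}|1\rangle\!\rangle\langle\!\langle1|$, where $\mathcal{F}=d\sum_j\frac{|\Pi_j\rangle\!\rangle\langle\!\langle\Pi_j|}{\tr(\Pi_j)}$. An IC measurement is quasi-balanced if $\mathcal{E}(\rho)$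 is unitarily invariant, i.e. $\mathcal{E}(U\rho U^\dagger)=\mathcal{E}(\rho)$ for all unitary $U$ and all such $\rho$. It is balanced if it is quasi-balanced and, in addition, the scaled mean square error matrix $\mathcal{C}$ at the completely mixed state is unchanged when all outcomes are transformed as $\Pi_j\mapsto U\Pi_jU^\dagger$, for every unitary $U$. A measurement $\{\Pi_j=P_j/d\}$ is a generalized SIC measurement if it is IC and $\tr(P_jP_k)=\alpha\delta_{jk}+\zeta$ for all $j,k$, for some real constants $\alpha,\zeta$. *)

theory Defs
  imports "HOL-Analysis.Analysis"
begin

type_synonym 'n operator = "complex ^ 'n ^ 'n"
type_synonym 'n superoperator = "'n operator \<Rightarrow> 'n operator"


section \<open>Operators on $C^d$, where $d$ is the cardinality of the index type\<close>

definition dagger :: "'n::finite operator \<Rightarrow> 'n operator" where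
  "dagger A = (\<chi> i j. cnj (A $ j $ i))"

definition hermitian :: "'n::finite operator \<Rightarrow> bool" where
  "hermitian A \<longleftrightarrow> dagger A = A"

definition unitary :: "'n::finite operator \<Rightarrow> bool" where
  "unitary U \<longleftrightarrow> dagger U ** U = mat 1 \<and> U ** dagger U = mat 1"

definition uconj :: "'n::finite operator \<Rightarrow> 'n operator \<Rightarrow> 'n operator" where
  "uconj U A = U ** A ** dagger U"

definition quad_form :: "'n::finite operator \<Rightarrow> complex ^ 'n \<Rightarrow> complex" where
  "quad_form A x = (\<Sum>i\<in>UNIV. cnj (x $ i) * (A *v x) $ i)"

text \<open>The quadratic form of a Hermitian operator is real, so the real part below discards nothing.\<close>

definition pos_semidef :: "'n::finite operator \<Rightarrow> bool" where
  "pos_semidef A \<longleftrightarrow> hermitian A \<and> (\<forall>x. 0 \<le> Re (quad_form A x))"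

definition pos_def :: "'n::finite operator \<Rightarrow> bool" where
  "pos_def A \<longleftrightarrow> hermitian A \<and> (\<forall>x. x \<noteq> 0 \<longrightarrow> 0 < Re (quad_form A x))"

definition is_state :: "'n::finite operator \<Rightarrow> bool" where
  "is_state \<rho> \<longleftrightarrow> pos_semidef \<rho> \<and> trace \<rho> = 1"

text \<open>
  The operator space as a complex vector space.  The library's \<open>*s\<close> scales by the entry type of the
  outer vector and its \<open>span\<close> is the real span, so the complex structure is made explicit here.
\<close>

definition op_scale :: "complex \<Rightarrow> 'n::finite operator \<Rightarrow> 'n operator" (infixr "*\<^sub>o" 75) where
  "c *\<^sub>o A = (\<chi> i j. c * A $ i $ j)"

global_interpretation operators: vector_space "op_scale :: complex \<Rightarrow> 'n::finite operator \<Rightarrow> _"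
  by unfold_locales (simp_all add: op_scale_def vec_eq_iff algebra_simps)

definition hs_inner :: "'n::finite operator \<Rightarrow> 'n operator \<Rightarrow> complex" where
  "hs_inner A B = trace (dagger A ** B)"


section \<open>Superoperators\<close>

text \<open>The superoperator $|A\rangle\rangle\langle\langle B|$.\<close>

definition ketbra :: "'n::finite operator \<Rightarrow> 'n operator \<Rightarrow> 'n superoperator" where
  "ketbra A B = (\<lambda>X. hs_inner B X *\<^sub>o A)"

definition matrix_unit :: "'n::finite \<Rightarrow> 'n \<Rightarrow> 'n operator" where
  "matrix_unit k l = (\<chi> i j. if i = k \<and> j = l then 1 else 0)"

text \<open>
  The trace of a superoperator, computed in the orthonormal basis of matrix units; intended for
  linear superoperators only.
\<close>

definition super_trace :: "'n::finite superoperator \<Rightarrow> complex" where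
  "super_trace L = (\<Sum>k\<in>UNIV. \<Sum>l\<in>UNIV. hs_inner (matrix_unit k l) (L (matrix_unit k l)))"


section \<open>Measurements\<close>

text \<open>
  A measurement is a finite family of outcomes $\Pi_j$, written \<open>E j\<close>, indexed by \<open>j \<in> J\<close>; values of
  \<open>E\<close> outside \<open>J\<close> are irrelevant.  In a minimal informationally complete measurement the outcomes
  are linearly independent, so a family carries no more information than a set.
\<close>

definition measurement :: "'j set \<Rightarrow> ('j \<Rightarrow> 'n::finite operator) \<Rightarrow> bool" where
  "measurement J E \<longleftrightarrow>
     finite J \<and> (\<forall>j\<in>J. pos_semidef (E j)) \<and> (\<Sum>j\<in>J. E j) = mat 1"

definition ic_measurement :: "'j set \<Rightarrow> ('j \<Rightarrow> 'n::finite operator) \<Rightarrow> bool" where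
  "ic_measurement J E \<longleftrightarrow> measurement J E \<and> operators.span (E ` J) = UNIV"

definition minimal_ic_measurement :: "'j set \<Rightarrow> ('j \<Rightarrow> 'n::finite operator) \<Rightarrow> bool" where
  "minimal_ic_measurement J E \<longleftrightarrow> ic_measurement J E \<and> card J = CARD('n)\<^sup>2"


section \<open>Mean square error\<close>

definition prob :: "'n::finite operator \<Rightarrow> 'n operator \<Rightarrow> complex" where
  "prob Q \<rho> = trace (Q ** \<rho>)"

text \<open>
  For positive definite \<open>\<rho>\<close> the probability of an outcome vanishes only if the outcome itself is
  zero; such a term contributes nothing below, in accordance with \<open>1 / 0 = 0\<close>.
\<close>

definition frame_superop :: "'j set \<Rightarrow> ('j \<Rightarrow> 'n::finite operator) \<Rightarrow> 'n operator \<Rightarrow> 'n superoperator"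
  where "frame_superop J E \<rho> =
    (\<lambda>X. \<Sum>j\<in>J. (1 / prob (E j) \<rho>) *\<^sub>o ketbra (E j) (E j) X)"

definition scaled_mse :: "'j set \<Rightarrow> ('j \<Rightarrow> 'n::finite operator) \<Rightarrow> 'n operator \<Rightarrow> complex" where
  "scaled_mse J E \<rho> = super_trace (inv (frame_superop J E \<rho>)) - trace (\<rho> ** \<rho>)"

definition frame_superop_mixed :: "'j set \<Rightarrow> ('j \<Rightarrow> 'n::finite operator) \<Rightarrow> 'n superoperator"
  where "frame_superop_mixed J E =
    (\<lambda>X. of_nat CARD('n) *\<^sub>o (\<Sum>j\<in>J. (1 / trace (E j)) *\<^sub>o ketbra (E j) (E j) X))"

definition scaled_mse_matrix_mixed :: "'j set \<Rightarrow> ('j \<Rightarrow> 'n::finite operator) \<Rightarrow> 'n superoperator"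
  where "scaled_mse_matrix_mixed J E =
    (\<lambda>X. inv (frame_superop_mixed J E) X
         - (1 / (of_nat CARD('n))\<^sup>2) *\<^sub>o ketbra (mat 1) (mat 1) X)"

lemma frame_superop_mixed_eq:
  fixes E :: "'j \<Rightarrow> 'n::finite operator"
  shows "frame_superop_mixed J E = frame_superop J E ((1 / of_nat CARD('n)) *\<^sub>o mat 1)"
proof -
  have "prob (E j) ((1 / of_nat CARD('n)) *\<^sub>o mat 1) = trace (E j) / of_nat CARD('n)" for j
    by (simp add: prob_def trace_def op_scale_def matrix_matrix_mult_def mat_def
        if_distrib if_distribR sum_divide_distrib cong: if_cong)
  then show ?thesis
    by (simp add: frame_superop_mixed_def frame_superop_def operators.scale_sum_right)
qed


section \<open>Balanced and generalized SIC measurements\<close>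

definition quasi_balanced :: "'j set \<Rightarrow> ('j \<Rightarrow> 'n::finite operator) \<Rightarrow> bool" where
  "quasi_balanced J E \<longleftrightarrow> ic_measurement J E \<and>
     (\<forall>U \<rho>. unitary U \<longrightarrow> is_state \<rho> \<longrightarrow> pos_def \<rho> \<longrightarrow>
        scaled_mse J E (uconj U \<rho>) = scaled_mse J E \<rho>)"

definition balanced :: "'j set \<Rightarrow> ('j \<Rightarrow> 'n::finite operator) \<Rightarrow> bool" where
  "balanced J E \<longleftrightarrow> quasi_balanced J E \<and>
     (\<forall>U. unitary U \<longrightarrow>
        scaled_mse_matrix_mixed J (\<lambda>j. uconj U (E j)) = scaled_mse_matrix_mixed J E)"

text \<open>The operators $P_j$ of a generalized SIC are determined by \<open>E j = P j / d\<close>.\<close>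

definition generalized_sic :: "'j set \<Rightarrow> ('j \<Rightarrow> 'n::finite operator) \<Rightarrow> bool" where
  "generalized_sic J E \<longleftrightarrow> ic_measurement J E \<and>
     (\<exists>P. (\<forall>j\<in>J. E j = (1 / of_nat CARD('n)) *\<^sub>o P j) \<and>
       (\<exists>\<alpha> \<zeta> :: real. \<forall>j\<in>J. \<forall>k\<in>J.
          trace (P j ** P k) = of_real (\<alpha> * (if j = k then 1 else 0) + \<zeta>)))"

end

theory Submission
  imports Defs
begin

text \<open>
  The outcomes $\Pi_j$ form a basis; let $\Theta_j$ be the dual basis.  Then
  $\mathcal{F}(\rho)^{-1} = \sum_j p_j |\Theta_j\rangle\rangle\langle\langle\Theta_j|$, so that
  $\mathcal{E}(\rho) = \mathrm{tr}(Q\rho) - \mathrm{tr}(\rho^2)$ with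
  $Q = \sum_j \|\Theta_j\|^2 \Pi_j$, and quasi-balance means that $Q$ is a multiple of $1$, i.e. that
  $\|\Theta_j\|^2$ does not depend on $j$.  Invariance of $\mathcal{C}$ means that
  $\mathcal{F}(1/d)^{-1}$ commutes with unitary conjugation and hence has the form
  $X \mapsto aX + f(X) 1$.  Evaluating this at $\Pi_k$, where the left side is
  $\mathrm{tr}(\Pi_k)\Theta_k/d$, and pairing with $1$, $\Theta_k$ and $\Pi_j$ forces equal traces
  and the Gram matrix of a generalized SIC.  Conversely, that Gram matrix gives
  $\mathcal{F}(1/d)(X) = \alpha X + \zeta d\, \mathrm{tr}(X) 1$.
\<close>

section \<open>Operator algebra\<close>

abbreviation superop_linear :: "'n::finite superoperator \<Rightarrow> bool" where
  "superop_linear \<equiv> module_hom op_scale op_scale"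

abbreviation commutator :: "'n::finite operator \<Rightarrow> 'n operator \<Rightarrow> 'n operator" where
  "commutator A B \<equiv> A ** B - B ** A"

lemma superop_linearI:
  assumes "\<And>X Y. G (X + Y) = G X + G Y" and "\<And>c X. G (c *\<^sub>o X) = c *\<^sub>o G X"
  shows "superop_linear G"
  using assms by (intro module_hom.intro module_hom_axioms.intro operators.module_axioms)

lemma op_scale_nth [simp]: "(c *\<^sub>o A) $ i $ j = c * A $ i $ j"
  by (simp add: op_scale_def)

lemma dagger_nth [simp]: "dagger A $ i $ j = cnj (A $ j $ i)"
  by (simp add: dagger_def)

lemma mat_mult_nth: "(A ** B) $ i $ j = (\<Sum>k\<in>UNIV. A $ i $ k * B $ k $ j)"
  by (simp add: matrix_matrix_mult_def)

lemma mat_mult_scale_left [simp]: "(c *\<^sub>o A) ** B = c *\<^sub>o (A ** B)"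
  and mat_mult_scale_right [simp]: "A ** (c *\<^sub>o B) = c *\<^sub>o (A ** B)"
  by (simp_all add: vec_eq_iff mat_mult_nth sum_distrib_left mult_ac)

lemma mat_mult_distribs:
  fixes A B C :: "'n::finite operator"
  shows "A ** (B + C) = A ** B + A ** C" "(A + B) ** C = A ** C + B ** C"
    "A ** (B - C) = A ** B - A ** C" "(A - B) ** C = A ** C - B ** C"
  by (simp_all add: vec_eq_iff mat_mult_nth algebra_simps sum.distrib sum_subtractf)

lemma dagger_simps [simp]:
  "dagger (dagger A) = A" "dagger (A + B) = dagger A + dagger B"
  "dagger (A - B) = dagger A - dagger B" "dagger (c *\<^sub>o A) = cnj c *\<^sub>o dagger A"
  "dagger (mat 1) = mat 1" "dagger (A ** B) = dagger B ** dagger A"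
  by (simp_all add: vec_eq_iff mat_mult_nth mat_def mult_ac)

lemma trace_op_scale [simp]: "trace (c *\<^sub>o A) = c * trace A"
  by (simp add: trace_def sum_distrib_left)

lemma trace_mat_one: "trace (mat 1 :: 'n::finite operator) = of_nat CARD('n)"
  by (simp add: trace_def mat_def)

lemma hs_inner_nth: "hs_inner A B = (\<Sum>k\<in>UNIV. \<Sum>l\<in>UNIV. cnj (A $ k $ l) * B $ k $ l)"
  unfolding hs_inner_def trace_def by (subst sum.swap) (simp add: mat_mult_nth)

lemma hs_inner_simps [simp]:
  "hs_inner A (B + C) = hs_inner A B + hs_inner A C"
  "hs_inner A (B - C) = hs_inner A B - hs_inner A C"
  "hs_inner A (c *\<^sub>o B) = c * hs_inner A B"
  "hs_inner (A - B) C = hs_inner A C - hs_inner B C"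
  "hs_inner (c *\<^sub>o A) B = cnj c * hs_inner A B"
  "hs_inner A 0 = 0" "hs_inner 0 B = 0"
  "hs_inner (mat 1) A = trace A"
  by (simp_all add: hs_inner_def trace_add trace_sub mat_mult_distribs)
     (simp_all add: trace_def mat_mult_nth)

lemma hs_inner_sum_right: "hs_inner A (\<Sum>x\<in>S. f x) = (\<Sum>x\<in>S. hs_inner A (f x))"
  by (induction S rule: infinite_finite_induct) auto

lemma cnj_hs_inner: "cnj (hs_inner A B) = hs_inner B A"
  by (simp add: hs_inner_nth mult.commute)

lemma hs_inner_hermitian: "hermitian A \<Longrightarrow> hs_inner A B = trace (A ** B)"
  by (simp add: hs_inner_def hermitian_def)

lemma hs_inner_matrix_unit: "hs_inner (matrix_unit k l) A = A $ k $ l"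
proof -
  have "cnj (matrix_unit k l $ i $ j) * A $ i $ j =
      (if i = k then if j = l then A $ i $ j else 0 else 0)" for i j
    by (simp add: matrix_unit_def)
  then have "hs_inner (matrix_unit k l) A =
      (\<Sum>i\<in>UNIV. if i = k then (\<Sum>j\<in>UNIV. if j = l then A $ i $ j else 0) else 0)"
    unfolding hs_inner_nth by (intro sum.cong) auto
  then show ?thesis
    by simp
qed

text \<open>Agreement on \<open>S\<close> extends to the span by linearity, and testing against
  matrix units then recovers every entry. The varying operator is moved to the second slot first, so
  that the span induction meets no conjugated scalars.\<close>

lemma hs_inner_eqI:
  assumes "operators.span S = UNIV" and "\<And>A. A \<in> S \<Longrightarrow> hs_inner A X = hs_inner A Y"
  shows "X = Y"
proof -
  have "hs_inner X' X = hs_inner X' Y" for X'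
  proof -
    have "X' \<in> operators.span S"
      using assms(1) by simp
    then have "hs_inner X X' = hs_inner Y X'"
    proof (induction rule: operators.span_induct_alt)
      case (step c A B)
      have "hs_inner X A = hs_inner Y A"
        using assms(2)[OF step(1)] cnj_hs_inner by metis
      then show ?case
        using step by simp
    qed simp
    then show ?thesis
      using cnj_hs_inner by metis
  qed
  then show ?thesis
    using hs_inner_matrix_unit by (metis vec_eq_iff)
qed

lemma matrix_unit_expansion:
  fixes A :: "'n::finite operator"
  shows "A = (\<Sum>k\<in>UNIV. \<Sum>l\<in>UNIV. A $ k $ l *\<^sub>o matrix_unit k l)"
proof -
  have "(\<Sum>k\<in>UNIV. \<Sum>l\<in>UNIV. (A $ k $ l *\<^sub>o matrix_unit k l) $ i $ j) = A $ i $ j" for i j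
  proof -
    have "(A $ k $ l *\<^sub>o matrix_unit k l) $ i $ j =
        (if k = i then if l = j then A $ k $ l else 0 else 0)" for k l
      by (auto simp: matrix_unit_def)
    then have "(\<Sum>k\<in>UNIV. \<Sum>l\<in>UNIV. (A $ k $ l *\<^sub>o matrix_unit k l) $ i $ j) =
        (\<Sum>k\<in>UNIV. if k = i then (\<Sum>l\<in>UNIV. if l = j then A $ k $ l else 0) else 0)"
      by (intro sum.cong) (auto simp del: op_scale_nth)
    then show ?thesis
      by (simp del: op_scale_nth)
  qed
  then show ?thesis
    by (simp add: vec_eq_iff)
qed

lemma super_trace_ketbra: "super_trace (ketbra A B) = hs_inner B A"
proof -
  have "hs_inner B (matrix_unit k l) = cnj (B $ k $ l)" for k l
    by (metis cnj_hs_inner hs_inner_matrix_unit)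
  then show ?thesis
    by (simp add: super_trace_def ketbra_def hs_inner_matrix_unit hs_inner_nth[of B A])
qed

section \<open>Unitary conjugation\<close>

lemma uconj_simps [simp]:
  "uconj U (A + B) = uconj U A + uconj U B"
  "uconj U (A - B) = uconj U A - uconj U B"
  "uconj U (c *\<^sub>o A) = c *\<^sub>o uconj U A"
  by (simp_all add: uconj_def mat_mult_distribs)

lemma uconj_sum: "uconj U (\<Sum>x\<in>S. f x) = (\<Sum>x\<in>S. uconj U (f x))"
  by (induction S rule: infinite_finite_induct) (auto simp: uconj_def mat_mult_distribs)

lemma uconj_uconj: "uconj U (uconj V A) = uconj (U ** V) A"
  by (simp add: uconj_def matrix_mul_assoc)

lemma uconj_inverse:
  assumes "unitary U"
  shows "uconj U (uconj (dagger U) A) = A" and "uconj (dagger U) (uconj U A) = A"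
  using assms by (simp_all add: uconj_uconj unitary_def) (simp_all add: uconj_def)

lemma uconj_one: "unitary U \<Longrightarrow> uconj U (mat 1) = mat 1"
  by (simp add: uconj_def unitary_def)

lemma uconj_mult: "unitary U \<Longrightarrow> uconj U A ** uconj U B = uconj U (A ** B)"
  unfolding uconj_def unitary_def
  by (metis matrix_mul_assoc matrix_mul_lid)

lemma trace_uconj: "unitary U \<Longrightarrow> trace (uconj U A) = trace A"
  unfolding uconj_def unitary_def
  by (metis matrix_mul_assoc matrix_mul_lid trace_mul_sym)

lemma hermitian_uconj: "hermitian A \<Longrightarrow> hermitian (uconj U A)"
  by (simp add: hermitian_def uconj_def matrix_mul_assoc)

lemma hs_inner_uconj: "unitary U \<Longrightarrow> hs_inner (uconj U A) (uconj U B) = hs_inner A B"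
proof -
  assume U: "unitary U"
  have "dagger (uconj U A) = uconj U (dagger A)"
    by (simp add: uconj_def matrix_mul_assoc)
  then show ?thesis
    by (simp add: hs_inner_def uconj_mult[OF U] trace_uconj[OF U])
qed

section \<open>Positivity\<close>

text \<open>The rank-one operator |v><w|. The diagonal ones \<open>outer v v\<close> are the
  building blocks of positive operators and also span the whole operator space.\<close>

definition outer :: "complex ^ 'n \<Rightarrow> complex ^ 'n \<Rightarrow> 'n::finite operator" where
  "outer v w = (\<chi> i j. v $ i * cnj (w $ j))"

lemma outer_nth [simp]: "outer v w $ i $ j = v $ i * cnj (w $ j)"
  by (simp add: outer_def)

lemma quad_form_eq: "quad_form A x = (\<Sum>i\<in>UNIV. \<Sum>j\<in>UNIV. cnj (x $ i) * A $ i $ j * x $ j)"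
  by (simp add: quad_form_def matrix_vector_mult_def sum_distrib_left mult_ac)

lemma trace_outer_mult: "trace (outer v v ** A) = quad_form A v"
  unfolding quad_form_eq trace_def mat_mult_nth
  by (subst sum.swap) (simp add: mult_ac)

lemma quad_form_linear:
  "quad_form (A + B) x = quad_form A x + quad_form B x"
  "quad_form (A - B) x = quad_form A x - quad_form B x"
  "quad_form (c *\<^sub>o A) x = c * quad_form A x"
  by (simp_all add: quad_form_eq algebra_simps sum.distrib sum_subtractf sum_distrib_left)

lemma quad_form_outer: "quad_form (outer v v) x = of_real ((cmod (\<Sum>i\<in>UNIV. cnj (v $ i) * x $ i))\<^sup>2)"
proof -
  let ?s = "\<Sum>i\<in>UNIV. cnj (v $ i) * x $ i"
  have "quad_form (outer v v) x = cnj ?s * ?s"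
    by (simp add: quad_form_eq sum_product) (simp add: mult_ac)
  then show ?thesis
    by (metis complex_norm_square mult.commute)
qed

lemma quad_form_mat_one: "quad_form (mat 1) x = of_real (\<Sum>i\<in>UNIV. (cmod (x $ i))\<^sup>2)"
  unfolding quad_form_def
  by (simp add: complex_norm_square mult.commute del: of_real_power)

lemma quad_form_uconj: "quad_form (uconj U A) x = quad_form A (dagger U *v x)"
proof -
  have *: "(\<Sum>i\<in>UNIV. cnj (x $ i) * (U *v y) $ i) = (\<Sum>i\<in>UNIV. cnj ((dagger U *v x) $ i) * y $ i)" for y
    by (simp add: matrix_vector_mult_def sum_distrib_left sum_distrib_right)
       (subst sum.swap, simp add: mult_ac)
  show ?thesis
    unfolding quad_form_def uconj_def
    by (simp add: matrix_vector_mul_assoc[symmetric] *)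
qed

lemma pos_def_uconj:
  assumes "unitary U" and "pos_def A"
  shows "pos_def (uconj U A)"
proof -
  have "dagger U *v x \<noteq> 0" if "x \<noteq> 0" for x
    using that assms(1) unfolding unitary_def
    by (metis matrix_vector_mul_assoc matrix_vector_mul_lid matrix_vector_mult_0_right)
  then show ?thesis
    using assms by (auto simp: pos_def_def hermitian_uconj quad_form_uconj)
qed

lemma pos_def_imp_pos_semidef: "pos_def A \<Longrightarrow> pos_semidef A"
proof -
  have "quad_form A 0 = 0"
    by (simp add: quad_form_def)
  then show "pos_def A \<Longrightarrow> pos_semidef A"
    unfolding pos_def_def pos_semidef_def by (metis less_eq_real_def zero_complex.sel(1))
qed

lemma pos_def_mat_one: "pos_def (mat 1 :: 'n::finite operator)"
proof -
  have "0 < (\<Sum>i\<in>UNIV. (cmod (x $ i))\<^sup>2)" if nz: "x \<noteq> 0" for x :: "complex ^ 'n"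
  proof -
    obtain i where "x $ i \<noteq> 0"
      using nz by (metis vec_eq_iff zero_index)
    then show ?thesis
      by (intro sum_pos2[of _ i]) auto
  qed
  then show ?thesis
    by (simp add: pos_def_def hermitian_def quad_form_mat_one del: of_real_sum)
qed

lemma mat_vec_axis: "(A *v axis i t) $ k = A $ k $ i * t"
  for A :: "'n::finite operator"
  by (simp add: matrix_vector_mult_def axis_def if_distrib cong: if_cong)

text \<open>Moving along one coordinate axis makes the form a quadratic polynomial in
  \<open>t\<close>; completing its square produces the Schur complement.\<close>

lemma quad_form_shift:
  fixes A :: "'n::finite operator"
  assumes "hermitian A"
  shows "quad_form A (x - axis i t) =
    quad_form A x - cnj t * (A *v x) $ i - t * cnj ((A *v x) $ i) + t * cnj t * A $ i $ i"
proof -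
  have h: "cnj (A $ i $ k) = A $ k $ i" for k
    using assms by (metis dagger_nth hermitian_def)
  have 1: "cnj ((A *v x) $ i) = (\<Sum>k\<in>UNIV. cnj (x $ k) * A $ k $ i)"
    by (simp add: matrix_vector_mult_def h mult.commute)
  have 2: "(\<Sum>k\<in>UNIV. f k * cnj (axis i t $ k)) = f i * cnj t" for f :: "'n \<Rightarrow> complex"
    by (simp add: axis_def if_distrib if_distribR cong: if_cong)
  show ?thesis
    unfolding quad_form_def 1
    by (simp add: mat_vec_axis algebra_simps sum.distrib sum_subtractf 2 sum_distrib_left[symmetric])
qed

text \<open>One step of a Cholesky decomposition: the Schur complement clears a row.\<close>

lemma pos_semidef_split:
  fixes A :: "'n::finite operator"
  assumes A: "pos_semidef A" and "A \<noteq> 0"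
  obtains B w and c :: real where "pos_semidef B" "A = B + of_real c *\<^sub>o outer w w" "0 < c" "w \<noteq> 0"
    "{i. B $ i \<noteq> 0} \<subset> {i. A $ i \<noteq> 0}"
proof -
  have herm: "hermitian A" and nonneg: "0 \<le> Re (quad_form A x)" for x
    using A by (auto simp: pos_semidef_def)
  have h: "cnj (A $ i $ k) = A $ k $ i" for i k
    using herm by (metis dagger_nth hermitian_def)
  obtain i j where ij: "A $ i $ j \<noteq> 0"
    using \<open>A \<noteq> 0\<close> by (metis vec_eq_iff zero_index)
  define r where "r = Re (A $ i $ i)"
  have Aii: "A $ i $ i = of_real r"
    using h[of i i] by (metis Reals_cnj_iff of_real_Re r_def)
  \<comment> \<open>The shift is taken proportional to \<open>(A *v x) $ i\<close>, which makes all
    correction terms real and leaves a real parameter \<open>s\<close> to choose.\<close>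
  have bound: "0 \<le> Re (quad_form A x) - 2 * s * (cmod ((A *v x) $ i))\<^sup>2 + s\<^sup>2 * (cmod ((A *v x) $ i))\<^sup>2 * r"
    for x s
  proof -
    let ?z = "(A *v x) $ i"
    have "quad_form A (x - axis i (of_real s * ?z)) =
        quad_form A x - of_real (2 * s * (cmod ?z)\<^sup>2) + of_real (s\<^sup>2 * (cmod ?z)\<^sup>2 * r)"
      unfolding quad_form_shift[OF herm] Aii of_real_mult complex_norm_square
      by (simp add: algebra_simps power2_eq_square)
    then show ?thesis
      using nonneg[of "x - axis i (of_real s * ?z)"] by simp
  qed
  have "r \<ge> 0"
    using nonneg[of "axis i 1"]
    by (simp add: quad_form_def mat_vec_axis r_def) (simp add: axis_def if_distrib if_distribR cong: if_cong)
  \<comment> \<open>With a zero diagonal entry the bound is affine in \<open>s\<close> with slope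
    \<open>- 2 * m\<close>, hence negative for large \<open>s\<close>.\<close>
  have "r \<noteq> 0"
  proof
    assume "r = 0"
    define m where "m = (cmod (A $ i $ j))\<^sup>2"
    have "m > 0"
      using ij by (simp add: m_def)
    have "0 \<le> Re (quad_form A (axis j 1)) - 2 * s * m" for s
      using bound[of "axis j 1" s] \<open>r = 0\<close> by (simp add: mat_vec_axis m_def)
    from this[of "(\<bar>Re (quad_form A (axis j 1))\<bar> + 1) / m"] \<open>m > 0\<close> show False
      by simp
  qed
  with \<open>r \<ge> 0\<close> have "r > 0" by simp
  \<comment> \<open>Column \<open>i\<close> of \<open>A\<close>; subtracting
    \<open>outer w w\<close> divided by the pivot \<open>r\<close> clears row
    \<open>i\<close>.\<close>
  define w where "w = (\<chi> k. A $ k $ i)"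
  define B where "B = A - of_real (1 / r) *\<^sub>o outer w w"
  have B_nth: "B $ k $ l = A $ k $ l - A $ k $ i * A $ i $ l / of_real r" for k l
    by (simp add: B_def w_def h)
  show thesis
  proof
    show "A = B + of_real (1 / r) *\<^sub>o outer w w" "0 < 1 / r"
      using \<open>r > 0\<close> by (simp_all add: B_def)
    show "w \<noteq> 0"
      using Aii \<open>r > 0\<close> by (auto simp: w_def vec_eq_iff intro!: exI[of _ i])
    have "(\<Sum>k\<in>UNIV. cnj (w $ k) * x $ k) = (A *v x) $ i" for x
      by (simp add: w_def h matrix_vector_mult_def)
    \<comment> \<open>The choice \<open>s = 1 / r\<close> minimises the bound, and the minimum is
      the quadratic form of \<open>B\<close>.\<close>
    then have "0 \<le> Re (quad_form B x)" for x
      using bound[of x "1 / r"] \<open>r > 0\<close>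
      by (simp add: B_def quad_form_linear quad_form_outer power2_eq_square field_simps)
    moreover have "hermitian B"
      by (auto simp: hermitian_def vec_eq_iff B_nth h)
    ultimately show "pos_semidef B"
      by (simp add: pos_semidef_def)
    \<comment> \<open>Row \<open>i\<close> becomes zero and zero rows stay zero, so the set of
      nonzero rows shrinks strictly; its size is the induction measure of
      \<open>trace_mult_nonneg\<close>.\<close>
    have "B $ i = 0"
      using Aii \<open>r > 0\<close> by (simp add: vec_eq_iff B_nth)
    moreover have "A $ k = 0 \<Longrightarrow> B $ k = 0" for k
      by (simp add: vec_eq_iff B_nth)
    moreover have "A $ i \<noteq> 0"
      using ij by auto
    ultimately show "{i. B $ i \<noteq> 0} \<subset> {i. A $ i \<noteq> 0}"
      by auto
  qed
qed

text \<open>Splitting off rank-one terms exhausts \<open>A\<close>, and each term contributes a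
  nonnegative multiple of a value of the quadratic form of \<open>R\<close>.\<close>

lemma trace_mult_nonneg:
  fixes A R :: "'n::finite operator"
  assumes "pos_semidef A" and R: "pos_semidef R"
  shows "0 \<le> Re (trace (A ** R))"
  using assms(1)
proof (induction "card {i. A $ i \<noteq> 0}" arbitrary: A rule: less_induct)
  case less
  show ?case
  proof (cases "A = 0")
    case True
    then show ?thesis
      by (simp add: trace_def mat_mult_nth)
  next
    case False
    then obtain B w c where *: "pos_semidef B" "A = B + of_real c *\<^sub>o outer w w" "0 < (c::real)"
      "{i. B $ i \<noteq> 0} \<subset> {i. A $ i \<noteq> 0}"
      using pos_semidef_split[OF less.prems] by metis
    then have "0 \<le> Re (trace (B ** R))"
      using less.hyps by (simp add: psubset_card_mono)
    then show ?thesis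
      using *(2,3) R
      by (simp add: mat_mult_distribs trace_add trace_outer_mult pos_semidef_def)
  qed
qed

text \<open>A single rank-one term split off from \<open>A\<close> already contributes a positive
  amount, and the remainder cannot cancel it.\<close>

lemma trace_mult_pos:
  fixes A R :: "'n::finite operator"
  assumes A: "pos_semidef A" "A \<noteq> 0" and R: "pos_def R"
  shows "0 < Re (trace (A ** R))"
proof -
  obtain B w c where *: "pos_semidef B" "A = B + of_real c *\<^sub>o outer w w" "0 < (c::real)" "w \<noteq> 0"
    using pos_semidef_split[OF A] by metis
  have "0 \<le> Re (trace (B ** R))"
    using *(1) R by (simp add: trace_mult_nonneg pos_def_imp_pos_semidef)
  moreover have "0 < c * Re (quad_form R w)"
    using * R by (simp add: pos_def_def)
  ultimately show ?thesis
    using *(2) by (simp add: mat_mult_distribs trace_add trace_outer_mult)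
qed

section \<open>Superoperators commuting with unitary conjugation\<close>

text \<open>Polarization expresses \<open>outer v w\<close> through diagonal ones, and the matrix
  units are of this form.\<close>

lemma span_outer: "operators.span (range (\<lambda>v. outer v v)) = (UNIV :: 'n::finite operator set)"
proof -
  let ?S = "operators.span (range (\<lambda>v. outer v v :: 'n operator))"
  have polarization: "outer v w =
      (1/4) *\<^sub>o outer (v + w) (v + w) - (1/4) *\<^sub>o outer (v - w) (v - w)
      + (\<i>/4) *\<^sub>o outer (v + \<i> *s w) (v + \<i> *s w) - (\<i>/4) *\<^sub>o outer (v - \<i> *s w) (v - \<i> *s w)"
    for v w :: "complex ^ 'n"
    by (simp add: vec_eq_iff algebra_simps)
  have outer_in: "outer v w \<in> ?S" for v w :: "complex ^ 'n"
    unfolding polarization[of v w]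
    by (intro operators.span_add operators.span_diff operators.span_scale operators.span_base) auto
  have "matrix_unit k l = outer (axis k 1) (axis l 1)" for k l :: 'n
    by (auto simp: vec_eq_iff matrix_unit_def axis_def)
  then have "A \<in> ?S" for A
    by (subst matrix_unit_expansion) (intro operators.span_sum operators.span_scale, simp add: outer_in)
  then show ?thesis
    by auto
qed

lemma commutator_linear:
  fixes A B C :: "'n::finite operator"
  shows "commutator (c *\<^sub>o A + B) C = c *\<^sub>o commutator A C + commutator B C"
  by (simp add: mat_mult_distribs operators.scale_right_diff_distrib)

text \<open>
  A Hermitian involution \<open>S\<close> yields the unitaries \<open>S\<close> and \<open>(1 + \<i> S) / \<surd>2\<close>; comparing the two
  invariances gives the infinitesimal one.
\<close>

lemma commute_involution:
  fixes G :: "'n::finite superoperator"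
  assumes lin: "superop_linear G"
    and inv: "\<And>U X. unitary U \<Longrightarrow> G (uconj U X) = uconj U (G X)"
    and S: "hermitian S" "S ** S = mat 1"
  shows "G (commutator S X) = commutator S (G X)"
proof -
  interpret module_hom op_scale op_scale G by (rule lin)
  define c :: complex where "c = of_real (1 / sqrt 2)"
  have c: "c * c = 1/2" "cnj c = c"
    unfolding c_def by (simp_all flip: of_real_mult)
  then have c': "c * z * c = z / 2" for z
    by (metis mult.assoc mult.commute mult_1 times_divide_eq_right)
  define U where "U = c *\<^sub>o (mat 1 + \<i> *\<^sub>o S)"
  have dS: "dagger S = S"
    using S by (simp add: hermitian_def)
  have dU: "dagger U = c *\<^sub>o (mat 1 - \<i> *\<^sub>o S)"
    by (simp add: U_def dS c operators.scale_right_diff_distrib operators.scale_right_distrib)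
  have "unitary U"
    unfolding unitary_def dU unfolding U_def
    by (simp add: mat_mult_distribs S c operators.scale_right_diff_distrib operators.scale_right_distrib)
       (simp add: vec_eq_iff c c' mat_def mult.assoc[symmetric])
  have conj: "uconj U Y = (1/2) *\<^sub>o (Y + uconj S Y + \<i> *\<^sub>o commutator S Y)" for Y
    unfolding uconj_def dU dS unfolding U_def
    by (simp add: mat_mult_distribs) (simp add: vec_eq_iff algebra_simps c mult.assoc[symmetric])
  have "unitary S"
    using S dS by (simp add: unitary_def)
  \<comment> \<open>Since \<open>G\<close> also commutes with conjugation by \<open>S\<close>, the
    first two terms agree on both sides and only the commutators remain to be compared.\<close>
  from inv[OF \<open>unitary U\<close>, of X] have "(1/2) *\<^sub>o (G X + uconj S (G X) + \<i> *\<^sub>o G (commutator S X)) =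
      (1/2) *\<^sub>o (G X + uconj S (G X) + \<i> *\<^sub>o commutator S (G X))"
    by (simp only: conj scale add inv[OF \<open>unitary S\<close>])
  then show ?thesis
    by (simp add: operators.scale_left_imp_eq)
qed

text \<open>The claim is linear in \<open>M\<close>, so the spanning operators
  \<open>outer v v\<close> suffice; each is, up to a scalar and a multiple of the identity, a
  Hermitian involution.\<close>

lemma commute_commutator:
  fixes G :: "'n::finite superoperator"
  assumes lin: "superop_linear G"
    and inv: "\<And>U X. unitary U \<Longrightarrow> G (uconj U X) = uconj U (G X)"
  shows "G (commutator M X) = commutator M (G X)"
proof -
  interpret module_hom op_scale op_scale G by (rule lin)
  have "M \<in> operators.span (range (\<lambda>v. outer v v))"
    by (simp add: span_outer)
  then show ?thesis
  proof (induction rule: operators.span_induct_alt)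
    case base
    then show ?case by simp
  next
    case (step c A B)
    then obtain v where A: "A = outer v v"
      by auto
    have "G (commutator A X) = commutator A (G X)"
    proof (cases "v = 0")
      case True
      then have "A = 0"
        by (simp add: A vec_eq_iff)
      then show ?thesis
        by simp
    next
      case False
      define s where "s = (\<Sum>i\<in>UNIV. (cmod (v $ i))\<^sup>2)"
      have "s > 0"
        using pos_def_mat_one False by (auto simp: pos_def_def quad_form_mat_one s_def)
      \<comment> \<open>The reflection in the hyperplane orthogonal to \<open>v\<close>. The
        identity drops out of commutators, so \<open>S\<close> and \<open>A\<close> have
        proportional ones.\<close>
      define S where "S = mat 1 - of_real (2 / s) *\<^sub>o A"
      have "A ** A = of_real s *\<^sub>o A"
        by (simp add: A vec_eq_iff mat_mult_nth s_def sum_distrib_left sum_distrib_right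
            complex_norm_square mult_ac del: of_real_power)
      then have "S ** S = mat 1"
        using \<open>s > 0\<close> by (simp add: S_def mat_mult_distribs) (simp add: vec_eq_iff field_simps)
      moreover have "hermitian S"
        by (auto simp: hermitian_def S_def A vec_eq_iff mat_def)
      ultimately have "G (commutator S X) = commutator S (G X)"
        using commute_involution[OF lin inv] by blast
      moreover have "commutator S Y = of_real (-2 / s) *\<^sub>o commutator A Y" for Y
        by (simp add: S_def mat_mult_distribs) (simp add: vec_eq_iff algebra_simps)
      ultimately show ?thesis
        using \<open>s > 0\<close> by (simp only: scale) (simp add: operators.scale_left_imp_eq)
    qed
    then show ?case
      using step by (simp only: commutator_linear add scale)
  qed
qed

lemma matrix_unit_mult:
  "(matrix_unit i j ** A) $ k $ l = (if k = i then A $ j $ l else 0)"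
  "(A ** matrix_unit i j) $ k $ l = (if l = j then A $ k $ i else 0)"
proof -
  have "(matrix_unit i j ** A) $ k $ l = (\<Sum>m\<in>UNIV. if m = j then if k = i then A $ m $ l else 0 else 0)"
    unfolding mat_mult_nth by (rule sum.cong) (auto simp: matrix_unit_def)
  then show "(matrix_unit i j ** A) $ k $ l = (if k = i then A $ j $ l else 0)"
    by simp
  have "(A ** matrix_unit i j) $ k $ l = (\<Sum>m\<in>UNIV. if m = i then if l = j then A $ k $ m else 0 else 0)"
    unfolding mat_mult_nth by (rule sum.cong) (auto simp: matrix_unit_def)
  then show "(A ** matrix_unit i j) $ k $ l = (if l = j then A $ k $ i else 0)"
    by simp
qed

lemma matrix_unit_nth: "matrix_unit i j $ k $ l = (if k = i \<and> l = j then 1 else 0)"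
  by (auto simp: matrix_unit_def)

text \<open>
  The off-diagonal entries come from \<open>[e, [e, X]] = -2 e X e\<close> for a nilpotent matrix unit \<open>e\<close>, the
  differences of diagonal entries from the entries of \<open>[e, X]\<close>.
\<close>

lemma commutant_scalar:
  fixes G :: "'n::finite superoperator"
  assumes lin: "superop_linear G"
    and comm: "\<And>M X. G (commutator M X) = commutator M (G X)"
  obtains a f where "\<And>X. G X = a *\<^sub>o X + f X *\<^sub>o mat 1"
proof -
  interpret module_hom op_scale op_scale G by (rule lin)
  \<comment> \<open>The factor by which \<open>G\<close> acts on an off-diagonal entry; all these
    factors turn out to equal the scalar \<open>a\<close>.\<close>
  define b where "b i j = G (matrix_unit i j) $ i $ j" for i j
  \<comment> \<open>The double commutator isolates the entry at the transposed position
    \<open>(j, i)\<close>; the symmetry of \<open>b\<close> is established afterwards.\<close>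
  have off: "G X $ j $ i = b i j * X $ j $ i" if "i \<noteq> j" for X i j
  proof -
    let ?e = "matrix_unit i j"
    have dbl: "commutator ?e (commutator ?e Y) = (- 2 * Y $ j $ i) *\<^sub>o ?e" for Y
      using that by (auto simp: vec_eq_iff matrix_unit_mult matrix_unit_nth)
    have "(- 2 * X $ j $ i) *\<^sub>o G ?e = (- 2 * G X $ j $ i) *\<^sub>o ?e"
      using comm[of ?e "commutator ?e X"] by (simp only: dbl comm scale)
    then have "((- 2 * X $ j $ i) *\<^sub>o G ?e) $ i $ j = ((- 2 * G X $ j $ i) *\<^sub>o ?e) $ i $ j"
      by simp
    then show ?thesis
      by (simp add: b_def matrix_unit_nth mult.commute)
  qed
  have sym: "b i j = b j i" if "i \<noteq> j" for i j
    using off[of j i "matrix_unit i j"] that by (simp add: b_def matrix_unit_nth)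
  have diag: "G X $ j $ j - G X $ i $ i = b i j * (X $ j $ j - X $ i $ i)" if "i \<noteq> j" for X i j
  proof -
    have entry: "commutator (matrix_unit i j) Y $ i $ j = Y $ j $ j - Y $ i $ i" for Y
      by (simp add: matrix_unit_mult)
    show ?thesis
      using off[of j i "commutator (matrix_unit i j) X"] that
      unfolding comm entry by (simp add: sym)
  qed
  \<comment> \<open>The three diagonal differences around the cycle \<open>i\<close>,
    \<open>j\<close>, \<open>k\<close> sum to zero, which relates the two factors.\<close>
  have step: "b i j = b j k" if "i \<noteq> j" "j \<noteq> k" "i \<noteq> k" for i j k
  proof -
    let ?y = "\<lambda>m. G (matrix_unit j j) $ m $ m"
    have "?y j - ?y i = b i j" "?y k - ?y j = - b j k" "?y i - ?y k = 0"
      using diag[of i j "matrix_unit j j"] diag[of j k "matrix_unit j j"] diag[of k i "matrix_unit j j"] that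
      by (simp_all add: matrix_unit_nth)
    then show ?thesis
      by (simp add: algebra_simps)
  qed
  have row: "b i j = b i k" if "j \<noteq> i" "k \<noteq> i" for i j k
  proof (cases "j = k")
    case False
    then have "b j i = b i k"
      using that by (intro step) auto
    then show ?thesis
      using sym[of i j] that(1) by simp
  qed simp
  have const: "b i j = b k l" if "i \<noteq> j" "k \<noteq> l" for i j k l
  proof (cases "k = i")
    case True
    then show ?thesis
      using that by (simp only:) (intro row, auto)
  next
    case False
    have "b i j = b i k"
      using that False by (intro row) auto
    also have "\<dots> = b k i"
      using False by (intro sym) auto
    also have "\<dots> = b k l"
      using that False by (intro row) auto
    finally show ?thesis .
  qed
  \<comment> \<open>In dimension one there are no off-diagonal factors and any \<open>a\<close> will
    do.\<close>
  have "\<exists>a. \<forall>i j. i \<noteq> j \<longrightarrow> b i j = a"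
  proof (cases "\<exists>k l :: 'n. k \<noteq> l")
    case True
    then obtain k l :: 'n where "k \<noteq> l"
      by blast
    then have "\<forall>i j. i \<noteq> j \<longrightarrow> b i j = b k l"
      by (intro allI impI const)
    then show ?thesis ..
  qed blast
  then obtain a where a: "\<And>i j. i \<noteq> j \<Longrightarrow> b i j = a"
    by blast
  obtain i0 :: 'n where True by simp
  \<comment> \<open>After subtracting \<open>a\<close> times \<open>X\<close> all diagonal entries
    coincide, so one reference entry at \<open>i0\<close> gives the multiple of the
    identity.\<close>
  have "G X = a *\<^sub>o X + (G X $ i0 $ i0 - a * X $ i0 $ i0) *\<^sub>o mat 1" for X
  proof -
    have key: "G X $ k $ l = a * X $ k $ l + (G X $ i0 $ i0 - a * X $ i0 $ i0) * (if k = l then 1 else 0)" for k l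
    proof (cases "k = l")
      case True
      then show ?thesis
        using diag[of i0 k X] a[of i0 k] by (cases "i0 = k") (auto simp: algebra_simps)
    next
      case False
      then show ?thesis
        using off[of l k X] a[of l k] by simp
    qed
    show ?thesis
      unfolding vec_eq_iff
    proof (intro allI)
      fix k l
      show "G X $ k $ l = (a *\<^sub>o X + (G X $ i0 $ i0 - a * X $ i0 $ i0) *\<^sub>o mat 1) $ k $ l"
        using key[of k l] by (simp add: mat_def)
    qed
  qed
  then show thesis
    by (rule that)
qed

text \<open>Invariance makes the functional \<open>trace (Q ** X)\<close> vanish on commutators, and
  suitable commutators of matrix units expose the off-diagonal entries of \<open>Q\<close> and the
  differences of its diagonal ones.\<close>

lemma trace_invariant_scalar:
  fixes Q :: "'n::finite operator"
  assumes inv: "\<And>U v. unitary U \<Longrightarrow> trace (Q ** uconj U (outer v v)) = trace (Q ** outer v v)"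
  obtains c where "Q = c *\<^sub>o mat 1"
proof -
  have inv': "trace (Q ** uconj U X) = trace (Q ** X)" if U: "unitary U" for U X
  proof -
    have "X \<in> operators.span (range (\<lambda>v. outer v v))"
      by (simp add: span_outer)
    then show ?thesis
    proof (induction rule: operators.span_induct_alt)
      case base
      then show ?case by (simp add: uconj_def)
    next
      case (step c A B)
      then show ?case
        using inv[OF U] by (auto simp: mat_mult_distribs trace_add)
    qed
  qed
  \<comment> \<open>Turning the functional into a superoperator with scalar values makes
    \<open>commute_commutator\<close> applicable; the commutator on its right side is then
    zero.\<close>
  define G where "G X = trace (Q ** X) *\<^sub>o (mat 1 :: 'n operator)" for X
  have "superop_linear G"
    by (rule superop_linearI) (simp_all add: G_def mat_mult_distribs trace_add operators.scale_left_distrib)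
  then have "G (commutator M X) = commutator M (G X)" for M X
    by (rule commute_commutator) (simp add: G_def inv' uconj_one)
  then have "G (commutator M X) = 0" for M X
    by (simp add: G_def)
  then have "trace (G (commutator M X)) = 0" for M X
    by (simp only:) (simp add: trace_def)
  then have comm: "trace (Q ** commutator M X) = 0" for M X
    by (simp add: G_def trace_mat_one)
  have entry: "trace (Q ** matrix_unit i j) = Q $ j $ i" for i j
    by (simp add: trace_def matrix_unit_mult)
  have "commutator (matrix_unit i i) (matrix_unit i j) = matrix_unit i j" if "i \<noteq> j" for i j :: 'n
    using that by (auto simp: vec_eq_iff matrix_unit_mult matrix_unit_nth)
  then have off: "Q $ j $ i = 0" if "i \<noteq> j" for i j
    using comm[of "matrix_unit i i" "matrix_unit i j"] that by (simp add: entry)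
  have "commutator (matrix_unit i j) (matrix_unit j i) = matrix_unit i i - matrix_unit j j" for i j :: 'n
    by (auto simp: vec_eq_iff matrix_unit_mult matrix_unit_nth)
  then have diag: "Q $ i $ i = Q $ j $ j" for i j
    using comm[of "matrix_unit i j" "matrix_unit j i"] by (simp add: mat_mult_distribs trace_sub entry)
  obtain i0 :: 'n where True by simp
  have "Q = Q $ i0 $ i0 *\<^sub>o mat 1"
    using off diag by (auto simp: vec_eq_iff mat_def)
  then show thesis
    by (rule that)
qed

section \<open>Dual bases\<close>

lemma matrix_unit_eq_iff: "matrix_unit i j = matrix_unit k l \<longleftrightarrow> i = k \<and> j = l"
  by (auto simp: vec_eq_iff matrix_unit_nth split: if_splits)

text \<open>This provides the dimension count: a spanning set has at least d^2 elements.\<close>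

lemma independent_matrix_units:
  "operators.independent (range (\<lambda>(k, l). matrix_unit k l :: 'n::finite operator))"
proof -
  let ?m = "\<lambda>(k, l). matrix_unit k l :: 'n operator"
  have inj: "inj ?m"
    by (auto simp: inj_on_def matrix_unit_eq_iff)
  have "u (?m (k, l)) = 0" if "(\<Sum>A\<in>range ?m. u A *\<^sub>o A) = 0" for u k l
  proof -
    have "0 = (\<Sum>p\<in>UNIV. u (?m p) *\<^sub>o ?m p) $ k $ l"
      using that by (simp add: sum.reindex[OF inj])
    also have "\<dots> = (\<Sum>p\<in>UNIV. if p = (k, l) then u (?m p) else 0)"
      unfolding sum_component by (rule sum.cong) (auto simp: matrix_unit_nth split: if_splits)
    finally show ?thesis
      by simp
  qed
  then show ?thesis
    by (subst operators.dependent_finite) auto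
qed

text \<open>As many spanning outcomes as the dimension form a basis, and each coordinate functional
  of that basis is an inner product with some operator.\<close>

lemma dual_basis_exists:
  fixes E :: "'j \<Rightarrow> 'n::finite operator"
  assumes "minimal_ic_measurement J E"
  obtains T where "\<And>j k. j \<in> J \<Longrightarrow> k \<in> J \<Longrightarrow> hs_inner (T j) (E k) = (if j = k then 1 else 0)"
proof -
  have fin: "finite J" and span: "operators.span (E ` J) = UNIV" and card: "card J = CARD('n)\<^sup>2"
    using assms by (auto simp: minimal_ic_measurement_def ic_measurement_def measurement_def)
  let ?M = "range (\<lambda>(k, l). matrix_unit k l :: 'n operator)"
  obtain B where B: "B \<subseteq> E ` J" "operators.independent B" "E ` J \<subseteq> operators.span B"
    using operators.maximal_independent_subset by blast
  have finB: "finite B"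
    using B(1) fin by (meson finite_imageI finite_subset)
  have spanB: "operators.span B = UNIV"
    using B(3) span operators.span_minimal operators.subspace_span by (metis top.extremum_uniqueI)
  have "card ?M \<le> card B"
    using operators.independent_span_bound[OF finB independent_matrix_units] spanB by simp
  moreover have "card ?M = CARD('n)\<^sup>2"
    by (subst card_image) (auto simp: inj_on_def matrix_unit_eq_iff power2_eq_square)
  moreover have "card B \<le> card (E ` J)" "card (E ` J) \<le> card J"
    using B(1) fin by (simp_all add: card_mono card_image_le)
  ultimately have "card B = card (E ` J)" "card (E ` J) = card J"
    using card by linarith+
  then have B_eq: "B = E ` J" and inj: "inj_on E J"
    using B(1) fin by (simp_all add: card_subset_eq eq_card_imp_inj_on)
  \<comment> \<open>The conjugate compensates for the antilinear first slot of
    \<open>hs_inner\<close>.\<close>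
  define T where "T j = (\<chi> k l. cnj (operators.representation B (matrix_unit k l) (E j)))" for j
  have "hs_inner (T j) X = operators.representation B X (E j)" for j X
  proof -
    have "operators.representation B X (E j) =
        operators.representation B (\<Sum>k\<in>UNIV. \<Sum>l\<in>UNIV. X $ k $ l *\<^sub>o matrix_unit k l) (E j)"
      by (simp flip: matrix_unit_expansion)
    also have "\<dots> = (\<Sum>k\<in>UNIV. \<Sum>l\<in>UNIV. X $ k $ l * operators.representation B (matrix_unit k l) (E j))"
      using B(2) spanB
      by (simp add: operators.representation_sum operators.representation_scale)
    finally show ?thesis
      by (simp add: hs_inner_nth T_def mult.commute)
  qed
  then have "hs_inner (T j) (E k) = (if j = k then 1 else 0)" if "j \<in> J" "k \<in> J" for j k
    using operators.representation_basis[OF B(2), of "E k"] B_eq inj that by (auto simp: inj_on_eq_iff)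
  then show thesis
    by (rule that)
qed

section \<open>Linearity and trace of weighted sums of rank-one superoperators\<close>

lemma superop_linear_ketbra_sum: "superop_linear (\<lambda>X. \<Sum>j\<in>J. w j *\<^sub>o ketbra (A j) (B j) X)"
  by (rule superop_linearI)
     (simp_all add: ketbra_def operators.scale_left_distrib operators.scale_right_distrib
       distrib_left sum.distrib operators.scale_sum_right mult_ac)

lemma super_trace_add_scale: "super_trace (\<lambda>X. c *\<^sub>o F X + G X) = c * super_trace F + super_trace G"
  by (simp add: super_trace_def sum.distrib sum_distrib_left)

lemma super_trace_ketbra_sum:
  "super_trace (\<lambda>X. \<Sum>j\<in>J. w j *\<^sub>o ketbra (A j) (B j) X) = (\<Sum>j\<in>J. w j * hs_inner (B j) (A j))"
proof (induction J rule: infinite_finite_induct)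
  case (insert j J)
  then show ?case
    by (simp add: super_trace_add_scale super_trace_ketbra)
qed (simp_all add: super_trace_def)

text \<open>Linear independence of the outcomes is encoded by the biorthogonal family
  \<open>T\<close>, the operators Theta_j of the overview.\<close>

locale dual_measurement =
  fixes J :: "'j set" and E T :: "'j \<Rightarrow> 'n::finite operator"
  assumes ic: "ic_measurement J E"
    and dual: "\<And>j k. j \<in> J \<Longrightarrow> k \<in> J \<Longrightarrow> hs_inner (T j) (E k) = (if j = k then 1 else 0)"
begin

lemma finite_J: "finite J"
  and pos_semidef_E: "j \<in> J \<Longrightarrow> pos_semidef (E j)"
  and hermitian_E: "j \<in> J \<Longrightarrow> hermitian (E j)"
  and sum_E: "(\<Sum>j\<in>J. E j) = mat 1"
  and span_E: "operators.span (E ` J) = UNIV"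
  using ic by (auto simp: ic_measurement_def measurement_def pos_semidef_def)

lemma dual': "j \<in> J \<Longrightarrow> k \<in> J \<Longrightarrow> hs_inner (E j) (T k) = (if j = k then 1 else 0)"
  using dual[of k j] by (metis cnj_hs_inner complex_cnj_one complex_cnj_zero)

lemma expansion_E: "(\<Sum>j\<in>J. hs_inner (T j) X *\<^sub>o E j) = X"
proof -
  have "X \<in> operators.span (E ` J)"
    by (simp add: span_E)
  then show ?thesis
  proof (induction rule: operators.span_induct_alt)
    case base
    then show ?case by simp
  next
    case (step c A B)
    then obtain k where k: "k \<in> J" "A = E k"
      by auto
    have "(\<Sum>j\<in>J. (c * hs_inner (T j) A) *\<^sub>o E j) = (\<Sum>j\<in>J. if j = k then c *\<^sub>o E j else 0)"
      using k dual by (intro sum.cong) auto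
    then show ?case
      using step k finite_J by (simp add: operators.scale_left_distrib sum.distrib)
  qed
qed

text \<open>Both sides have the same inner products with the outcomes, which span.\<close>

lemma expansion_T: "(\<Sum>j\<in>J. hs_inner (E j) X *\<^sub>o T j) = X"
proof (rule hs_inner_eqI[OF span_E])
  fix A assume "A \<in> E ` J"
  then obtain k where k: "k \<in> J" "A = E k"
    by auto
  have "hs_inner A (\<Sum>j\<in>J. hs_inner (E j) X *\<^sub>o T j) = (\<Sum>j\<in>J. if j = k then hs_inner (E j) X else 0)"
    unfolding hs_inner_sum_right using k dual' by (intro sum.cong) auto
  then show "hs_inner A (\<Sum>j\<in>J. hs_inner (E j) X *\<^sub>o T j) = hs_inner A X"
    using k finite_J by simp
qed

lemma E_nonzero: "j \<in> J \<Longrightarrow> E j \<noteq> 0"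
  using dual[of j j] by auto

lemma hs_inner_T_one: "k \<in> J \<Longrightarrow> hs_inner (T k) (mat 1) = 1"
  using finite_J by (simp add: sum_E[symmetric] hs_inner_sum_right dual)

lemma trace_T: "k \<in> J \<Longrightarrow> trace (T k) = 1"
  using hs_inner_T_one[of k] cnj_hs_inner[of "T k" "mat 1"] by simp

lemma sum_trace_E: "(\<Sum>j\<in>J. trace (E j)) = of_nat CARD('n)"
  using arg_cong[OF sum_E, of "hs_inner (mat 1)"] by (simp only: hs_inner_sum_right hs_inner_simps trace_mat_one)

text \<open>Guarantees that the weights \<open>1 / prob (E j) \<rho>\<close> never fall back on the
  default value of division by zero.\<close>

lemma prob_nonzero: "j \<in> J \<Longrightarrow> pos_def \<rho> \<Longrightarrow> prob (E j) \<rho> \<noteq> 0"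
  unfolding prob_def
  using trace_mult_pos[OF pos_semidef_E E_nonzero, of j \<rho>] by (metis order_less_irrefl zero_complex.sel(1))

lemma trace_E_nonzero: "j \<in> J \<Longrightarrow> trace (E j) \<noteq> 0"
  using prob_nonzero[OF _ pos_def_mat_one] by (simp add: prob_def)

section \<open>Inverting the frame superoperator\<close>

definition dual_frame :: "('j \<Rightarrow> complex) \<Rightarrow> 'n superoperator" where
  "dual_frame w = (\<lambda>X. \<Sum>j\<in>J. w j *\<^sub>o ketbra (T j) (T j) X)"

lemma hs_inner_dual_frame: "k \<in> J \<Longrightarrow> hs_inner (E k) (dual_frame w X) = w k * hs_inner (T k) X"
proof -
  assume k: "k \<in> J"
  have "hs_inner (E k) (dual_frame w X) = (\<Sum>j\<in>J. if j = k then w j * hs_inner (T j) X else 0)"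
    unfolding dual_frame_def hs_inner_sum_right using k
    by (intro sum.cong) (auto simp: ketbra_def dual')
  then show ?thesis
    using k finite_J by simp
qed

text \<open>\<open>F\<close> sends \<open>T k\<close> to \<open>E k\<close> divided by
  \<open>w k\<close>, and \<open>dual_frame w\<close> reverses this. General weights cover an
  arbitrary positive definite state as well as the completely mixed one.\<close>

lemma frame_inverse:
  assumes w: "\<And>j. j \<in> J \<Longrightarrow> w j \<noteq> 0"
    and F: "\<And>X. F X = (\<Sum>j\<in>J. (1 / w j) *\<^sub>o ketbra (E j) (E j) X)"
  shows "F (dual_frame w X) = X" and "dual_frame w (F X) = X" and "inv F = dual_frame w"
proof -
  have 1: "F (dual_frame w X) = X" for X
  proof -
    have "F (dual_frame w X) = (\<Sum>j\<in>J. hs_inner (T j) X *\<^sub>o E j)"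
      unfolding F ketbra_def using w by (intro sum.cong) (auto simp: hs_inner_dual_frame)
    then show ?thesis
      by (simp add: expansion_E)
  qed
  have 2: "dual_frame w (F X) = X" for X
  proof -
    have "hs_inner (T k) (F X) = hs_inner (E k) X / w k" if "k \<in> J" for k
    proof -
      have "hs_inner (T k) (F X) = (\<Sum>j\<in>J. if j = k then hs_inner (E j) X / w j else 0)"
        unfolding F hs_inner_sum_right using that
        by (intro sum.cong) (auto simp: ketbra_def dual)
      then show ?thesis
        using that finite_J by simp
    qed
    then have "dual_frame w (F X) = (\<Sum>j\<in>J. hs_inner (E j) X *\<^sub>o T j)"
      unfolding dual_frame_def ketbra_def using w by (intro sum.cong) auto
    then show ?thesis
      by (simp add: expansion_T)
  qed
  show "F (dual_frame w X) = X" "dual_frame w (F X) = X"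
    by (fact 1 2)+
  show "inv F = dual_frame w"
    using 1 2 by (intro inv_equality)
qed

lemma dual_frame_E: "k \<in> J \<Longrightarrow> dual_frame w (E k) = w k *\<^sub>o T k"
proof -
  assume k: "k \<in> J"
  have "dual_frame w (E k) = (\<Sum>j\<in>J. if j = k then w j *\<^sub>o T j else 0)"
    unfolding dual_frame_def using k by (intro sum.cong) (auto simp: ketbra_def dual)
  then show ?thesis
    using k finite_J by simp
qed

section \<open>Mean square error and quasi-balance\<close>

text \<open>The operator Q of the overview, which carries the part of the error that is linear in
  the state.\<close>

definition mse_operator :: "'n operator" where
  "mse_operator = (\<Sum>j\<in>J. hs_inner (T j) (T j) *\<^sub>o E j)"

lemma scaled_mse_eq:
  assumes "pos_def \<rho>"
  shows "scaled_mse J E \<rho> = trace (mse_operator ** \<rho>) - trace (\<rho> ** \<rho>)"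
proof -
  have "inv (frame_superop J E \<rho>) = dual_frame (\<lambda>j. prob (E j) \<rho>)"
    using assms by (intro frame_inverse(3)) (simp_all add: prob_nonzero frame_superop_def)
  moreover have "trace (mse_operator ** \<rho>) = (\<Sum>j\<in>J. hs_inner (T j) (T j) * prob (E j) \<rho>)"
  proof -
    have "trace ((\<Sum>j\<in>S. c j *\<^sub>o E j) ** \<rho>) = (\<Sum>j\<in>S. c j * prob (E j) \<rho>)" for c and S :: "'j set"
      by (induction S rule: infinite_finite_induct)
         (simp_all add: mat_mult_distribs trace_add prob_def, simp_all add: trace_def mat_mult_nth)
    then show ?thesis
      by (simp add: mse_operator_def)
  qed
  ultimately show ?thesis
    by (simp add: scaled_mse_def dual_frame_def super_trace_ketbra_sum mult.commute)
qed

text \<open>The squared norms are the coordinates of \<open>mse_operator\<close> in the basis of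
  outcomes, and those of the identity are all 1.\<close>

lemma mse_operator_scalar_iff:
  "mse_operator = c *\<^sub>o mat 1 \<longleftrightarrow> (\<forall>j\<in>J. hs_inner (T j) (T j) = c)"
proof
  assume *: "mse_operator = c *\<^sub>o mat 1"
  show "\<forall>j\<in>J. hs_inner (T j) (T j) = c"
  proof
    fix k assume k: "k \<in> J"
    have "hs_inner (T k) mse_operator = (\<Sum>j\<in>J. if j = k then hs_inner (T j) (T j) else 0)"
      unfolding mse_operator_def hs_inner_sum_right using k
      by (intro sum.cong) (auto simp: dual)
    then show "hs_inner (T k) (T k) = c"
      using k finite_J by (simp add: * hs_inner_T_one)
  qed
next
  assume "\<forall>j\<in>J. hs_inner (T j) (T j) = c"
  then show "mse_operator = c *\<^sub>o mat 1"
    by (simp add: mse_operator_def sum_E[symmetric] operators.scale_sum_right)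
qed

text \<open>The purity is unitarily invariant, so the condition concerns only the linear functional
  given by \<open>mse_operator\<close>, and \<open>trace_invariant_scalar\<close> applies.\<close>

lemma quasi_balanced_iff: "quasi_balanced J E \<longleftrightarrow> (\<exists>c. \<forall>j\<in>J. hs_inner (T j) (T j) = c)"
proof
  assume "\<exists>c. \<forall>j\<in>J. hs_inner (T j) (T j) = c"
  then obtain c where "mse_operator = c *\<^sub>o mat 1"
    using mse_operator_scalar_iff by blast
  then show "quasi_balanced J E"
    using ic by (auto simp: quasi_balanced_def scaled_mse_eq pos_def_uconj uconj_mult trace_uconj)
next
  assume qb: "quasi_balanced J E"
  have "trace (mse_operator ** uconj U (outer v v)) = trace (mse_operator ** outer v v)"
    if U: "unitary U" for U v
  proof -
    define s where "s = (\<Sum>i\<in>UNIV. (cmod (v $ i))\<^sup>2)"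
    have trace_v: "trace (outer v v) = of_real s"
      by (simp add: trace_def s_def complex_norm_square del: of_real_power)
    \<comment> \<open>Normalises \<open>mat 1 + outer v v\<close> to trace one. The identity keeps
      the state positive definite, is fixed by conjugation, and so cancels from the
      comparison.\<close>
    define r where "r = 1 / (real CARD('n) + s)"
    have "0 \<le> s"
      by (auto simp: s_def sum_nonneg)
    then have "0 < r"
      by (auto simp: r_def add_pos_nonneg)
    define \<rho> where "\<rho> = of_real r *\<^sub>o (mat 1 + outer v v)"
    have "hermitian \<rho>"
      by (auto simp: hermitian_def \<rho>_def vec_eq_iff mat_def)
    then have pd: "pos_def \<rho>"
      using \<open>0 < r\<close> pos_def_mat_one
      by (auto simp: pos_def_def \<rho>_def quad_form_linear quad_form_outer add_pos_nonneg)
    have "trace \<rho> = of_real (r * (real CARD('n) + s))"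
      by (simp add: \<rho>_def trace_add trace_mat_one trace_v)
    also have "r * (real CARD('n) + s) = 1"
      using \<open>0 < r\<close> by (auto simp: r_def)
    finally have "is_state \<rho>"
      using pd by (simp add: is_state_def pos_def_imp_pos_semidef)
    then have "scaled_mse J E (uconj U \<rho>) = scaled_mse J E \<rho>"
      using qb U pd by (auto simp: quasi_balanced_def)
    then have "trace (mse_operator ** uconj U \<rho>) = trace (mse_operator ** \<rho>)"
      by (simp add: scaled_mse_eq pd pos_def_uconj U uconj_mult trace_uconj)
    then show ?thesis
      using \<open>0 < r\<close> by (simp add: \<rho>_def uconj_one U mat_mult_distribs trace_add)
  qed
  then obtain c where "mse_operator = c *\<^sub>o mat 1"
    by (rule trace_invariant_scalar)
  then show "\<exists>c. \<forall>j\<in>J. hs_inner (T j) (T j) = c"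
    using mse_operator_scalar_iff by blast
qed

section \<open>The error matrix at the completely mixed state\<close>

abbreviation mixed_weight :: "'j \<Rightarrow> complex" where
  "mixed_weight j \<equiv> trace (E j) / of_nat CARD('n)"

lemma frame_superop_mixed_sum:
  "frame_superop_mixed J E X = (\<Sum>j\<in>J. (1 / mixed_weight j) *\<^sub>o ketbra (E j) (E j) X)"
  by (simp add: frame_superop_mixed_def operators.scale_sum_right)

lemmas mixed_inverse = frame_inverse[where F = "frame_superop_mixed J E" and w = mixed_weight,
    OF _ frame_superop_mixed_sum]

lemma mixed_weight_nonzero: "j \<in> J \<Longrightarrow> mixed_weight j \<noteq> 0"
  by (simp add: trace_E_nonzero)

lemma frame_superop_mixed_uconj:
  assumes U: "unitary U"
  shows "frame_superop_mixed J (\<lambda>j. uconj U (E j)) (uconj U X) = uconj U (frame_superop_mixed J E X)"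
  by (simp add: frame_superop_mixed_def ketbra_def uconj_sum hs_inner_uconj[OF U] trace_uconj[OF U])

lemma superop_linear_mixed: "superop_linear (frame_superop_mixed J E)"
  unfolding frame_superop_mixed_sum[abs_def] by (rule superop_linear_ketbra_sum)

lemma superop_linear_dual_frame: "superop_linear (dual_frame w)"
  unfolding dual_frame_def by (rule superop_linear_ketbra_sum)

text \<open>The term built from the identity occurs in both matrices and cancels. By covariance of
  the frame, transforming the outcomes conjugates its inverse by \<open>uconj U\<close>.\<close>

lemma mse_matrix_invariant_iff:
  assumes U: "unitary U"
  shows "scaled_mse_matrix_mixed J (\<lambda>j. uconj U (E j)) = scaled_mse_matrix_mixed J E \<longleftrightarrow>
    (\<forall>X. dual_frame mixed_weight (uconj U X) = uconj U (dual_frame mixed_weight X))"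
proof -
  let ?G = "dual_frame mixed_weight"
  have "inv (frame_superop_mixed J (\<lambda>j. uconj U (E j))) = (\<lambda>X. uconj U (?G (uconj (dagger U) X)))"
  proof (rule inv_equality)
    fix X
    show "uconj U (?G (uconj (dagger U) (frame_superop_mixed J (\<lambda>j. uconj U (E j)) X))) = X"
      using frame_superop_mixed_uconj[OF U, of "uconj (dagger U) X"]
      by (simp add: uconj_inverse[OF U] mixed_inverse(2)[OF mixed_weight_nonzero])
    show "frame_superop_mixed J (\<lambda>j. uconj U (E j)) (uconj U (?G (uconj (dagger U) X))) = X"
      by (simp add: uconj_inverse[OF U] frame_superop_mixed_uconj[OF U]
          mixed_inverse(1)[OF mixed_weight_nonzero])
  qed
  then have "scaled_mse_matrix_mixed J (\<lambda>j. uconj U (E j)) = scaled_mse_matrix_mixed J E \<longleftrightarrow>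
      (\<forall>X. uconj U (?G (uconj (dagger U) X)) = ?G X)"
    by (simp add: scaled_mse_matrix_mixed_def fun_eq_iff mixed_inverse(3)[OF mixed_weight_nonzero])
  also have "\<dots> \<longleftrightarrow> (\<forall>X. ?G (uconj U X) = uconj U (?G X))"
    by (metis uconj_inverse[OF U])
  finally show ?thesis .
qed

section \<open>Gram matrices and the two implications\<close>

text \<open>Inner products of Hermitian outcomes are real, so the real parts of \<open>u\<close> and
  \<open>v\<close> serve as constants, scaled by d^2 because each \<open>?P j\<close> is d times
  \<open>E j\<close>.\<close>

lemma generalized_sicI:
  fixes u v :: complex
  assumes gram: "\<And>j k. j \<in> J \<Longrightarrow> k \<in> J \<Longrightarrow> hs_inner (E j) (E k) = u * (if j = k then 1 else 0) + v"
  shows "generalized_sic J E"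
proof -
  let ?d = "of_nat CARD('n) :: complex"
  let ?P = "\<lambda>j. ?d *\<^sub>o E j"
  define \<alpha> \<zeta> where "\<alpha> = (real CARD('n))\<^sup>2 * Re u" and "\<zeta> = (real CARD('n))\<^sup>2 * Re v"
  have "trace (?P j ** ?P k) = of_real (\<alpha> * (if j = k then 1 else 0) + \<zeta>)"
    if jk: "j \<in> J" "k \<in> J" for j k
  proof -
    have "cnj (hs_inner (E j) (E k)) = hs_inner (E j) (E k)"
      using jk unfolding cnj_hs_inner by (metis hs_inner_hermitian hermitian_E trace_mul_sym)
    then have "hs_inner (E j) (E k) = of_real (Re (hs_inner (E j) (E k)))"
      by (metis Reals_cnj_iff of_real_Re)
    also have "Re (hs_inner (E j) (E k)) = Re u * (if j = k then 1 else 0) + Re v"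
      using gram[OF jk] by simp
    finally have "trace (E j ** E k) = of_real (Re u * (if j = k then 1 else 0) + Re v)"
      using jk by (simp add: hs_inner_hermitian hermitian_E)
    then show ?thesis
      by (simp add: \<alpha>_def \<zeta>_def power2_eq_square algebra_simps)
  qed
  then show ?thesis
    unfolding generalized_sic_def using ic by (intro conjI exI[of _ ?P] exI[of _ \<alpha>] exI[of _ \<zeta>]) auto
qed

lemma balanced_imp_generalized_sic:
  assumes bal: "balanced J E"
  shows "generalized_sic J E"
proof -
  let ?d = "of_nat CARD('n) :: complex"
  let ?G = "dual_frame mixed_weight"
  obtain c where c: "\<And>j. j \<in> J \<Longrightarrow> hs_inner (T j) (T j) = c"
    using bal by (auto simp: balanced_def quasi_balanced_iff)
  have "?G (uconj U X) = uconj U (?G X)" if "unitary U" for U X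
    using bal that mse_matrix_invariant_iff by (auto simp: balanced_def)
  then obtain a f where G: "\<And>X. ?G X = a *\<^sub>o X + f X *\<^sub>o mat 1"
    using commutant_scalar[OF superop_linear_dual_frame commute_commutator[OF superop_linear_dual_frame]]
    by metis
  have key: "mixed_weight k *\<^sub>o T k = a *\<^sub>o E k + f (E k) *\<^sub>o mat 1" if "k \<in> J" for k
    using G[of "E k"] dual_frame_E[OF that] by metis
  have f: "f (E k) = (mixed_weight k - a * trace (E k)) / ?d" if "k \<in> J" for k
    using arg_cong[OF key[OF that], of trace] trace_T[OF that]
    by (simp add: trace_add trace_mat_one field_simps)
  \<comment> \<open>Pairing with \<open>E j\<close> makes the left side a Kronecker delta by
    biorthogonality, leaving the Gram matrix on the right.\<close>
  have gram: "mixed_weight k * (if j = k then 1 else 0) = a * hs_inner (E j) (E k) + f (E k) * trace (E j)"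
    if "j \<in> J" "k \<in> J" for j k
    using arg_cong[OF key[OF that(2)], of "hs_inner (E j)"] that hermitian_E
    by (simp add: dual' hs_inner_hermitian[of "E j" "mat 1"])
  have norm: "mixed_weight k * c = a + f (E k)" if "k \<in> J" for k
    using arg_cong[OF key[OF that], of "hs_inner (T k)"] that by (simp add: c dual hs_inner_T_one)
  show ?thesis
  proof (cases "a = 0")
    case True \<comment> \<open>only possible for \<open>d = 1\<close>, where \<open>a\<close> and \<open>f\<close> are not determined by \<open>?G\<close>\<close>
    \<comment> \<open>Here \<open>f (E k)\<close> equals \<open>mixed_weight k / ?d\<close>, which
      is nonzero, while \<open>gram\<close> for two distinct outcomes would force it to
      vanish.\<close>
    have "j = k" if "j \<in> J" "k \<in> J" for j k
    proof (rule ccontr)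
      assume "j \<noteq> k"
      then have "f (E k) * trace (E j) = 0"
        using gram[OF that] True by simp
      then show False
        using f[OF that(2)] True trace_E_nonzero that by simp
    qed
    \<comment> \<open>At most one outcome is left, so the Gram matrix has at most one entry, and
      this entry is taken as the constant.\<close>
    then have "hs_inner (E j) (E k) = 0 * (if j = k then 1 else 0) + hs_inner (E (SOME j. j \<in> J)) (E (SOME j. j \<in> J))"
      if "j \<in> J" "k \<in> J" for j k
      using that by (metis add_0 mult_zero_left some_in_eq empty_iff)
    then show ?thesis
      by (rule generalized_sicI)
  next
    case False
    \<comment> \<open>Eliminating \<open>f (E k)\<close> between the trace identity and the pairing
      with \<open>T k\<close> leaves an equation whose other coefficients do not depend on
      \<open>k\<close>; hence all weights agree.\<close>
    have w: "mixed_weight k * (c - 1 / ?d + a) = a" if "k \<in> J" for k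
      using norm[OF that] f[OF that] by (simp add: field_simps)
    define w where "w = a / (c - 1 / ?d + a)"
    have "c - 1 / ?d + a \<noteq> 0" if "k \<in> J" for k
      using w[OF that] False by auto
    then have w_eq: "mixed_weight k = w" if "k \<in> J" for k
      using w[OF that] that by (auto simp: w_def eq_divide_eq)
    then have tr: "trace (E k) = ?d * w" if "k \<in> J" for k
      using that by (auto simp: field_simps)
    have "hs_inner (E j) (E k) =
        (w / a) * (if j = k then 1 else 0) + (- ((w - a * (?d * w)) * w / a))"
      if jk: "j \<in> J" "k \<in> J" for j k
    proof -
      have "a * hs_inner (E j) (E k) = w * (if j = k then 1 else 0) - (w - a * (?d * w)) * w"
        using gram[OF jk] unfolding w_eq[OF jk(2)] f[OF jk(2)] tr[OF jk(1)] tr[OF jk(2)] by simp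
      then have "hs_inner (E j) (E k) = (w * (if j = k then 1 else 0) - (w - a * (?d * w)) * w) / a"
        using False by (simp add: eq_divide_eq mult.commute)
      then show ?thesis
        by (simp add: diff_divide_distrib)
    qed
    then show ?thesis
      by (rule generalized_sicI)
  qed
qed

lemma generalized_sic_imp_balanced:
  assumes sic: "generalized_sic J E" and card: "card J = CARD('n)\<^sup>2"
  shows "balanced J E"
proof -
  let ?d = "of_nat CARD('n) :: complex"
  let ?F = "frame_superop_mixed J E"
  let ?G = "dual_frame mixed_weight"
  obtain P and \<alpha> \<zeta> :: real where P: "\<And>j. j \<in> J \<Longrightarrow> E j = (1 / ?d) *\<^sub>o P j"
    and gramP: "\<And>j k. j \<in> J \<Longrightarrow> k \<in> J \<Longrightarrow>
      trace (P j ** P k) = of_real (\<alpha> * (if j = k then 1 else 0) + \<zeta>)"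
    using sic by (auto simp: generalized_sic_def)
  have gram: "?d\<^sup>2 * hs_inner (E j) (E k) = of_real \<alpha> * (if j = k then 1 else 0) + of_real \<zeta>"
    if "j \<in> J" "k \<in> J" for j k
    using hs_inner_hermitian[OF hermitian_E[OF that(1)], of "E k"] gramP[OF that]
    by (simp add: P that power2_eq_square)
  have tr: "trace (E k) = 1 / ?d" if k: "k \<in> J" for k
  proof -
    \<comment> \<open>The outcomes sum to the identity, so the trace of \<open>E l\<close> is a row
      sum of the Gram matrix over d^2 outcomes. It is the same for every \<open>l\<close>, and the
      total trace d then fixes it.\<close>
    have "?d\<^sup>2 * trace (E l) = of_real \<alpha> + ?d\<^sup>2 * of_real \<zeta>" if l: "l \<in> J" for l
    proof -
      have "trace (E l) = hs_inner (E l) (\<Sum>j\<in>J. E j)"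
        using hs_inner_hermitian[OF hermitian_E[OF l], of "mat 1"] by (simp add: sum_E)
      then have "?d\<^sup>2 * trace (E l) = (\<Sum>j\<in>J. ?d\<^sup>2 * hs_inner (E l) (E j))"
        by (simp add: hs_inner_sum_right sum_distrib_left)
      also have "\<dots> = (\<Sum>j\<in>J. (if j = l then of_real \<alpha> else 0) + of_real \<zeta>)"
        using l by (intro sum.cong) (auto simp: gram)
      finally show ?thesis
        using l finite_J card by (simp add: sum.distrib)
    qed
    then have "?d\<^sup>2 * trace (E l) = ?d\<^sup>2 * trace (E k)" if "l \<in> J" for l
      using k that by simp
    then have "(\<Sum>l\<in>J. trace (E l)) = (\<Sum>l\<in>J. trace (E k))"
      by (intro sum.cong) auto
    then show ?thesis
      by (simp add: sum_trace_E card power2_eq_square field_simps)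
  qed
  have F_E: "?F (E k) = of_real \<alpha> *\<^sub>o E k + of_real \<zeta> *\<^sub>o mat 1" if k: "k \<in> J" for k
  proof -
    \<comment> \<open>Equal traces 1/d turn every frame weight into d^2, the factor appearing in
      \<open>gram\<close>.\<close>
    have "?F (E k) = (\<Sum>j\<in>J. (?d\<^sup>2 * hs_inner (E j) (E k)) *\<^sub>o E j)"
      unfolding frame_superop_mixed_sum
      by (intro sum.cong) (auto simp: tr ketbra_def power2_eq_square)
    also have "\<dots> = (\<Sum>j\<in>J. (if j = k then of_real \<alpha> *\<^sub>o E j else 0) + of_real \<zeta> *\<^sub>o E j)"
      using k by (intro sum.cong) (auto simp: gram operators.scale_left_distrib)
    finally show ?thesis
      using k finite_J by (simp add: sum.distrib sum_E flip: operators.scale_sum_right)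
  qed
  have F: "?F X = of_real \<alpha> *\<^sub>o X + (of_real \<zeta> * ?d * trace X) *\<^sub>o mat 1" for X
  proof -
    interpret module_hom op_scale op_scale ?F by (rule superop_linear_mixed)
    have "X \<in> operators.span (E ` J)"
      by (simp add: span_E)
    then show ?thesis
    proof (induction rule: operators.span_induct_alt)
      case base
      then show ?case by (simp add: trace_def)
    next
      case (step c A B)
      then have "?F A = of_real \<alpha> *\<^sub>o A + (of_real \<zeta> * ?d * trace A) *\<^sub>o mat 1"
        by (auto simp: F_E tr)
      with step show ?case
        by (simp add: add scale trace_add vec_eq_iff algebra_simps)
    qed
  qed
  have GF: "?G (?F X) = X" and FG: "?F (?G X) = X" for X
    using mixed_inverse(1,2)[OF mixed_weight_nonzero] by auto
  have "?G (uconj U X) = uconj U (?G X)" if U: "unitary U" for U X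
  proof -
    \<comment> \<open>The explicit form of \<open>?F\<close> visibly commutes with conjugation;
      applying \<open>?G\<close> to both sides carries this over to the inverse.\<close>
    have "?F (uconj U (?G X)) = uconj U (?F (?G X))"
      by (simp add: F trace_uconj U uconj_one)
    then show ?thesis
      using GF FG by metis
  qed
  then have inv: "\<forall>U. unitary U \<longrightarrow>
      scaled_mse_matrix_mixed J (\<lambda>j. uconj U (E j)) = scaled_mse_matrix_mixed J E"
    by (simp add: mse_matrix_invariant_iff)
  have "\<exists>c. \<forall>j\<in>J. hs_inner (T j) (T j) = c"
  \<comment> \<open>If \<alpha> vanishes, \<open>?F\<close> maps all outcomes to the same multiple
    of the identity, and its injectivity leaves a single outcome.\<close>
  proof (cases "\<alpha> = 0")
    case True
    have "j = k" if "j \<in> J" "k \<in> J" for j k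
    proof -
      have "E j = E k"
        using F_E[OF that(1)] F_E[OF that(2)] GF True by (metis of_real_0 operators.scale_zero_left)
      then show ?thesis
        using dual[OF that(1) that(1)] dual[OF that] by (auto split: if_splits)
    qed
    then show ?thesis
      by metis
  next
    case False
    \<comment> \<open>The value results from pairing \<open>T k\<close> with \<open>E k\<close>,
      written as \<open>?F\<close> of \<open>T k\<close> divided by d^2, and solving for the squared
      norm.\<close>
    have "hs_inner (T k) (T k) = (?d\<^sup>2 - of_real \<zeta> * ?d) / of_real \<alpha>" if k: "k \<in> J" for k
    proof -
      have "E k = ?F (mixed_weight k *\<^sub>o T k)"
        using FG[of "E k"] k by (simp add: dual_frame_E)
      then have "hs_inner (T k) (E k) = hs_inner (T k) (?F (mixed_weight k *\<^sub>o T k))"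
        by simp
      then show ?thesis
        using False k by (simp add: F dual tr trace_T hs_inner_T_one power2_eq_square field_simps)
    qed
    then show ?thesis
      by blast
  qed
  then show ?thesis
    using inv by (simp add: balanced_def quasi_balanced_iff)
qed

end

theorem theorem2:
  fixes J :: "'j set" and E :: "'j \<Rightarrow> complex ^ 'n::finite ^ 'n"
  assumes "minimal_ic_measurement J E"
  shows "balanced J E \<longleftrightarrow> generalized_sic J E"
proof -
  obtain T where "\<And>j k. j \<in> J \<Longrightarrow> k \<in> J \<Longrightarrow> hs_inner (T j) (E k) = (if j = k then 1 else 0)"
    using dual_basis_exists[OF assms] by metis
  then interpret dual_measurement J E T
    using assms by unfold_locales (auto simp: minimal_ic_measurement_def)
  have "card J = CARD('n)\<^sup>2"
    using assms by (simp add: minimal_ic_measurement_def)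
  then show ?thesis
    using balanced_imp_generalized_sic generalized_sic_imp_balanced by blast
qed

end
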